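(* (Blatz–Ko–Ogden model, entropy condition.) Let $\lambda,\mu,\rho_0>0$, $\beta=\frac{\lambda}{2\mu}$, $f\in(0,1)$, and for $\Gamma>-1$ let $$P(\Gamma)=\frac{\mu(1+\Gamma)}{\rho_0}\Big\{f\big[1-(1+\Gamma)^{-2\beta-2}\big]+\frac{1-f}{(1+\Gamma)^4}\big[(1+\Gamma)^{2\beta+2}-1\big]\Big\}.$$ Write $s=1+\Gamma$ (and $s=1+\Gamma_l$ for the compression shock $S(\Gamma_l)$). (i) If $0<\beta\le\frac52$, then $P''<0$ for all $s\in(0,1]$. (ii) Let $\beta=\frac n2$ with $n$ an integer, $n>5$. Then there exists $f_\beta\in(0,1)$ (depending only on $\beta$) such that: if $f\ge f_\beta$, then $S(\Gamma_l)$ satisfies the entropy condition for the standard entropy function for all $s\in(0,1]$; if $f<f_\beta$, then there exists $s_\beta\in(0,1]$ (depending on $\beta$ and $f$) such that the condition holds for all $s\in(0,s_\beta)$, does not hold for $s\in(s_\beta,1)$, and holds at $s=1$.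
   Context: The p-system is $V_t-(P(\Gamma))_X=0$, $\Gamma_t-V_X=0$, with $\Gamma>-1$. The compression shock $S(\Gamma_l)$, $\Gamma_l\in(-1,0)$, is $(V,\Gamma)=(-V_0,0)$ for $X>\sigma t$, $(V,\Gamma)=(0,\Gamma_l)$ for $X<\sigma t$, with $V_0=\sqrt{\Gamma_lP(\Gamma_l)}$, $\sigma=-V_0/\Gamma_l$; $S(0)=(0,0)$. The standard entropy/entropy-flux pair is $\Phi(V,\Gamma)=\frac{V^2}{2}+\int_0^\Gamma P(w)\,dw$, $\Psi(V,\Gamma)=-P(\Gamma)V$; for $S(\Gamma_l)$ the corresponding entropy condition is by definition the inequality $2\int_0^{\Gamma_l}P(w)\,dw\le\Gamma_lP(\Gamma_l)$. *)

theory Defs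
  imports "HOL-Analysis.Analysis"
begin

definition bko_beta :: "real \<Rightarrow> real \<Rightarrow> real" where
  "bko_beta lam mu = lam / (2 * mu)"

text \<open>Blatz--Ko--Ogden stress; meaningful for \<open>\<Gamma> > -1\<close>.\<close>

definition bko_stress :: "real \<Rightarrow> real \<Rightarrow> real \<Rightarrow> real \<Rightarrow> real \<Rightarrow> real" where
  "bko_stress lam mu rho0 f \<Gamma> =
     (let \<beta> = bko_beta lam mu in
      mu * (1 + \<Gamma>) / rho0 *
        (f * (1 - (1 + \<Gamma>) powr (- 2 * \<beta> - 2))
         + (1 - f) / (1 + \<Gamma>) ^ 4 * ((1 + \<Gamma>) powr (2 * \<beta> + 2) - 1)))"

text \<open>
  For the p-system \<open>V\<^sub>t - P(\<Gamma>)\<^sub>X = 0\<close>, \<open>\<Gamma>\<^sub>t - V\<^sub>X = 0\<close>, the entropy condition of the compression shock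
  \<open>S(\<Gamma>l)\<close> for the standard entropy \<open>V\<^sup>2/2 + \<integral>\<^sub>0\<^sup>\<Gamma> P\<close> and flux \<open>-P(\<Gamma>) V\<close> is, by definition, the
  following inequality.  The integral is oriented: \<open>\<Gamma>l \<le> 0\<close>, so the upper limit is the smaller one.
\<close>

definition shock_entropy_condition :: "(real \<Rightarrow> real) \<Rightarrow> real \<Rightarrow> bool" where
  "shock_entropy_condition P \<Gamma>l \<longleftrightarrow>
     2 * (LBINT w=ereal 0..ereal \<Gamma>l. P w) \<le> \<Gamma>l * P \<Gamma>l"

end

(* Write b = 2 \<beta> and let p be the stress as a function of s, so that the entropy condition for S(s - 1)
   reads E(s) \<ge> 0 with E(s) = (s - 1) p(s) - 2 (integral of p from 1 to s).  Then E(1) = E'(1) = 0 and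
   E''(s) = (s - 1) p''(s).  The function s^5 p''(s) is strictly increasing for b > 2, hence p'' changes
   sign at most once, and f_\<beta> = (b - 5) / (2 b - 4) is the value of f for which p''(1) = 0.  For
   f \<ge> f_\<beta> the function E is convex and nonnegative on (0, 1].  For f < f_\<beta> it is convex on some (0, s0]
   and negative on [s0, 1); since it tends to infinity at 0, it changes sign exactly once in (0, s0). *)
theory Submission
  imports Defs "HOL-Real_Asymp.Real_Asymp"
begin

section \<open>The stress as a function of s without the factor \<open>mu / rho0\<close>, and its
  calculus\<close>

definition profile :: "real \<Rightarrow> real \<Rightarrow> real \<Rightarrow> real" where
  "profile b f s = f * (s - s powr (- b - 1)) + (1 - f) * (s powr (b - 1) - s powr (- 3))"

definition profile_deriv :: "real \<Rightarrow> real \<Rightarrow> real \<Rightarrow> real" where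
  "profile_deriv b f s =
     f * (1 + (b + 1) * s powr (- b - 2)) + (1 - f) * ((b - 1) * s powr (b - 2) + 3 * s powr (- 4))"

definition profile_deriv2 :: "real \<Rightarrow> real \<Rightarrow> real \<Rightarrow> real" where
  "profile_deriv2 b f s =
     - f * ((b + 1) * (b + 2) * s powr (- b - 3))
     + (1 - f) * ((b - 1) * (b - 2) * s powr (b - 3) - 12 * s powr (- 5))"

definition profile_primitive :: "real \<Rightarrow> real \<Rightarrow> real \<Rightarrow> real" where
  "profile_primitive b f s =
     f * (s\<^sup>2 / 2 + s powr (- b) / b) + (1 - f) * (s powr b / b + s powr (- 2) / 2)"

text \<open>Up to the positive factor \<open>mu / rho0\<close>, this is the right side minus the
  left side of the entropy condition; the lower limit \<Gamma> = 0 of the integral becomes s =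
  1.\<close>

definition entropy_excess :: "real \<Rightarrow> real \<Rightarrow> real \<Rightarrow> real" where
  "entropy_excess b f s =
     (s - 1) * profile b f s - 2 * (profile_primitive b f s - profile_primitive b f 1)"

text \<open>This is \<open>s\<^sup>5\<close> times the second derivative of the profile.\<close>

definition curvature :: "real \<Rightarrow> real \<Rightarrow> real \<Rightarrow> real" where
  "curvature b f s =
     (1 - f) * ((b - 1) * (b - 2) * s powr (b + 2) - 12) - f * (b + 1) * (b + 2) * s powr (2 - b)"

lemma bko_stress_eq:
  assumes "0 < 1 + x"
  shows "bko_stress lam mu rho0 f x = mu / rho0 * profile (2 * bko_beta lam mu) f (1 + x)"
proof -
  define b where "b = 2 * bko_beta lam mu"
  define s where "s = 1 + x"
  have s: "s > 0" using assms by (simp add: s_def)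
  have 1: "s * s powr (- b - 2) = s powr (- b - 1)"
    using s powr_mult_base[of s "- b - 2"] by (simp add: minus_diff_commute)
  have 2: "s / s ^ 4 * s powr (b + 2) = s powr (b - 1)"
  proof -
    have "s powr (b + 2) = s powr (b - 1) * s powr 3"
      by (simp add: powr_add[symmetric] add.commute)
    then show ?thesis using s by (simp add: powr_numeral field_simps eval_nat_numeral)
  qed
  have 3: "s / s ^ 4 = s powr (- 3)"
    using s by (simp add: powr_minus powr_numeral field_simps eval_nat_numeral)
  have "bko_stress lam mu rho0 f x =
        mu / rho0 * (f * (s - s * s powr (- b - 2)) + (1 - f) * (s / s ^ 4 * s powr (b + 2) - s / s ^ 4))"
    unfolding bko_stress_def Let_def b_def s_def by (simp add: algebra_simps diff_divide_distrib add_divide_distrib)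
  then show ?thesis unfolding 1 2 unfolding 3 by (simp add: profile_def b_def s_def)
qed

lemma profile_has_derivative:
  assumes "s > 0"
  shows "(profile b f has_real_derivative profile_deriv b f s) (at s)"
  unfolding profile_def[abs_def] profile_deriv_def
  by (rule derivative_eq_intros refl | (use assms in simp; fail))+
     (simp add: algebra_simps minus_diff_commute)

lemma profile_deriv_has_derivative:
  assumes "s > 0"
  shows "(profile_deriv b f has_real_derivative profile_deriv2 b f s) (at s)"
  unfolding profile_deriv_def[abs_def] profile_deriv2_def
  by (rule derivative_eq_intros refl | (use assms in simp; fail))+
     (simp add: algebra_simps minus_diff_commute)

lemma profile_primitive_has_derivative:
  assumes "s > 0" "b > 0"
  shows "(profile_primitive b f has_real_derivative profile b f s) (at s)"
  unfolding profile_primitive_def[abs_def] profile_def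
  by (rule derivative_eq_intros refl | (use assms in simp; fail))+

lemma profile_one [simp]: "profile b f 1 = 0"
  by (simp add: profile_def)

lemma entropy_excess_one [simp]: "entropy_excess b f 1 = 0"
  by (simp add: entropy_excess_def)

lemma entropy_excess_has_derivative:
  assumes "s > 0" "b > 0"
  shows "(entropy_excess b f has_real_derivative
            (s - 1) * profile_deriv b f s - profile b f s) (at s)"
  unfolding entropy_excess_def[abs_def]
  by (rule derivative_eq_intros refl profile_has_derivative profile_primitive_has_derivative assms)+
     (simp add: algebra_simps)

text \<open>The terms with \<open>profile_deriv\<close> cancel. The remaining factor s - 1 is
  negative on (0, 1), so the excess is convex where the profile is concave.\<close>

lemma entropy_excess_has_derivative2:
  assumes "s > 0"
  shows "((\<lambda>s. (s - 1) * profile_deriv b f s - profile b f s) has_real_derivative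
            (s - 1) * profile_deriv2 b f s) (at s)"
  by (rule derivative_eq_intros refl profile_has_derivative profile_deriv_has_derivative assms)+
     (simp add: algebra_simps)

section \<open>The sign of the second derivative of the profile\<close>

lemma profile_deriv2_eq:
  assumes "s > 0"
  shows "profile_deriv2 b f s = s powr (- 5) * curvature b f s"
proof -
  have "s powr (- b - 3) = s powr (- 5) * s powr (2 - b)"
    "s powr (b - 3) = s powr (- 5) * s powr (b + 2)"
    by (simp_all add: powr_add[symmetric] minus_diff_commute)
  then show ?thesis
    unfolding profile_deriv2_def curvature_def by (simp add: algebra_simps)
qed

lemma profile_deriv2_sign:
  assumes "s > 0"
  shows "profile_deriv2 b f s < 0 \<longleftrightarrow> curvature b f s < 0"
    and "profile_deriv2 b f s \<le> 0 \<longleftrightarrow> curvature b f s \<le> 0"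
    and "0 < profile_deriv2 b f s \<longleftrightarrow> 0 < curvature b f s"
  using assms by (simp_all add: profile_deriv2_eq mult_less_0_iff mult_le_0_iff zero_less_mult_iff)

text \<open>The factor s^5 makes the term with -12 constant. Of the two remaining powers, b + 2 is
  positive with a positive coefficient, and 2 - b is negative with a negative coefficient.\<close>

lemma curvature_strict_mono:
  assumes "0 < s" "s < t" "b > 2" "0 < f" "f < 1"
  shows "curvature b f s < curvature b f t"
proof -
  have "s powr (b + 2) < t powr (b + 2)"
    using assms by (intro powr_less_mono2) auto
  then have "(1 - f) * ((b - 1) * (b - 2) * s powr (b + 2) - 12)
           < (1 - f) * ((b - 1) * (b - 2) * t powr (b + 2) - 12)"
    using assms by simp
  moreover have "t powr (2 - b) \<le> s powr (2 - b)"
    using assms by (intro powr_mono2') auto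
  then have "f * (b + 1) * (b + 2) * t powr (2 - b) \<le> f * (b + 1) * (b + 2) * s powr (2 - b)"
    using assms by (intro mult_left_mono) auto
  ultimately show ?thesis unfolding curvature_def by linarith
qed

text \<open>Since (b - 1) (b - 2) - 12 = (b - 5) (b + 2), both summands contain b + 2. The other
  factor is affine in f, and its zero is the threshold f_\<beta>.\<close>

lemma curvature_one: "curvature b f 1 = (b + 2) * ((b - 5) - f * (2 * b - 4))"
  by (simp add: curvature_def algebra_simps)

text \<open>Here b may be at most 2, so the values are bounded directly instead of by monotonicity:
  (b - 1) (b - 2) is at most 12 and the power of s at most 1, hence the first summand is at most 0,
  while the second is strictly negative.\<close>

lemma curvature_neg:
  assumes "0 < b" "b \<le> 5" "0 < f" "f < 1" "0 < s" "s \<le> 1"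
  shows "curvature b f s < 0"
proof -
  have sp: "0 \<le> s powr (b + 2)" "s powr (b + 2) \<le> 1"
    using assms by (auto intro: powr_le1)
  have "(b - 1) * (b - 2) - 12 = (b - 5) * (b + 2)" by (simp add: algebra_simps)
  also have "\<dots> \<le> 0" using assms by (simp add: mult_le_0_iff)
  finally have "(b - 1) * (b - 2) \<le> 12" by simp
  then have "(b - 1) * (b - 2) * s powr (b + 2) \<le> 12 * s powr (b + 2)"
    using sp by (intro mult_right_mono) auto
  then have "(b - 1) * (b - 2) * s powr (b + 2) - 12 \<le> 0" using sp by linarith
  then have "(1 - f) * ((b - 1) * (b - 2) * s powr (b + 2) - 12) \<le> 0"
    using assms by (simp add: mult_le_0_iff)
  moreover have "0 < f * (b + 1) * (b + 2) * s powr (2 - b)"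
    using assms by simp
  ultimately show ?thesis unfolding curvature_def by linarith
qed

text \<open>Intermediate value theorem between 1 and a point where only the negative summand is
  left. That point lies in (0, 1] because b > 5 gives (b - 1) (b - 2) > 12.\<close>

lemma curvature_root:
  assumes "b > 5" "0 < f" "f < 1" "curvature b f 1 > 0"
  obtains s where "0 < s" "s < 1" "curvature b f s = 0"
proof -
  have "(b - 5) * (b + 2) > 0" using assms by simp
  then have b: "12 < (b - 1) * (b - 2)" by (simp add: algebra_simps)
  \<comment> \<open>the point at which the first summand of \<open>curvature\<close> vanishes\<close>
  define s where "s = (12 / ((b - 1) * (b - 2))) powr (1 / (b + 2))"
  have s0: "0 < s" using b by (auto simp: s_def)
  have "s powr (b + 2) = 12 / ((b - 1) * (b - 2))"
    using b assms by (simp add: s_def powr_powr)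
  then have "(b - 1) * (b - 2) * s powr (b + 2) = 12"
    using b by (simp only: nonzero_mult_div_cancel_left times_divide_eq_right)
  then have neg: "curvature b f s < 0"
    using s0 assms unfolding curvature_def by simp
  have "s \<le> 1" unfolding s_def using b assms by (intro powr_le1) auto
  moreover have "continuous_on {s..1} (curvature b f)"
    unfolding curvature_def[abs_def] using s0 by (intro continuous_intros) auto
  ultimately obtain z where z: "s \<le> z" "z \<le> 1" "curvature b f z = 0"
    using IVT'[of "curvature b f" s 0 1] neg assms by auto
  moreover have "z \<noteq> 1" using z assms by auto
  ultimately show ?thesis using that[of z] s0 by auto
qed

section \<open>The entropy condition as the sign of the excess\<close>

lemma shock_entropy_condition_iff:
  assumes "0 < mu" "0 < rho0" "0 < bko_beta lam mu" "0 < s" "s \<le> 1"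
  shows "shock_entropy_condition (bko_stress lam mu rho0 f) (s - 1) \<longleftrightarrow>
         0 \<le> entropy_excess (2 * bko_beta lam mu) f s"
proof -
  define b where "b = 2 * bko_beta lam mu"
  have b: "b > 0" using assms by (simp add: b_def)
  define c where "c = mu / rho0"
  have c: "c > 0" using assms by (simp add: c_def)
  let ?P = "bko_stress lam mu rho0 f"
  let ?F = "\<lambda>x. c * profile_primitive b f (1 + x)"
  have P: "?P x = c * profile b f (1 + x)" if "1 + x > 0" for x
    using bko_stress_eq[OF that] by (simp add: b_def c_def)
  \<comment> \<open>The limits of the integral are in reversed order; this identifies the interval
    on which the fundamental theorem asks for continuity and derivatives.\<close>
  have mm: "min 0 (s - 1) = s - 1" "max 0 (s - 1) = 0" using assms by auto
  have der: "(?F has_vector_derivative ?P x) (at x within {s - 1..0})" if "s - 1 \<le> x" for x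
  proof -
    have "((\<lambda>x. profile_primitive b f (1 + x)) has_real_derivative profile b f (1 + x) * 1) (at x)"
      by (rule DERIV_chain2[OF profile_primitive_has_derivative])
         (use that assms b in \<open>auto intro!: derivative_eq_intros\<close>)
    from DERIV_cmult[OF this, of c] have "(?F has_real_derivative ?P x) (at x)"
      using that assms by (simp add: P)
    then show ?thesis
      using has_real_derivative_iff_has_vector_derivative has_vector_derivative_at_within by blast
  qed
  have "continuous_on {s - 1..0} (\<lambda>x. c * profile b f (1 + x))"
    unfolding profile_def using assms by (intro continuous_intros) auto
  then have cont: "continuous_on {s - 1..0} ?P"
    by (rule continuous_on_cong[THEN iffD1, rotated -1]) (use assms P in auto)
  have "(LBINT w=ereal 0..ereal (s - 1). ?P w) = ?F (s - 1) - ?F 0"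
    by (rule interval_integral_FTC_finite) (use der cont mm in auto)
  then have "shock_entropy_condition ?P (s - 1) \<longleftrightarrow>
      2 * (c * profile_primitive b f s - c * profile_primitive b f 1) \<le> (s - 1) * (c * profile b f s)"
    unfolding shock_entropy_condition_def using P[of "s - 1"] assms by simp
  also have "\<dots> \<longleftrightarrow> 0 \<le> c * entropy_excess b f s"
    by (simp add: entropy_excess_def algebra_simps)
  finally have "shock_entropy_condition ?P (s - 1) \<longleftrightarrow> 0 \<le> c * entropy_excess b f s" .
  then show ?thesis using c by (simp add: b_def zero_le_mult_iff)
qed

section \<open>The sign of the excess from the sign of the curvature\<close>

lemma entropy_excess_nonneg:
  assumes "b > 0" "0 < s" "s \<le> 1" and curv: "\<And>t. 0 < t \<Longrightarrow> t \<le> 1 \<Longrightarrow> curvature b f t \<le> 0"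
  shows "0 \<le> entropy_excess b f s"
proof -
  let ?E1 = "\<lambda>s. (s - 1) * profile_deriv b f s - profile b f s"
  have E1: "?E1 t \<le> 0" if "0 < t" "t \<le> 1" for t
  proof -
    \<comment> \<open>Two integrations back from s = 1, where the excess and its derivative vanish:
      a nonnegative second derivative makes the first one nonpositive, and so the excess falls to
      0.\<close>
    have "?E1 t \<le> ?E1 1"
    proof (rule DERIV_nonneg_imp_nondecreasing[OF that(2)])
      fix x assume x: "t \<le> x" "x \<le> 1"
      have "0 \<le> (x - 1) * profile_deriv2 b f x"
        using curv[of x] x that by (simp add: zero_le_mult_iff profile_deriv2_sign)
      then show "\<exists>y. (?E1 has_real_derivative y) (at x) \<and> 0 \<le> y"
        using entropy_excess_has_derivative2[of x b f] x that by auto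
    qed
    then show ?thesis by simp
  qed
  have "entropy_excess b f 1 \<le> entropy_excess b f s"
  proof (rule DERIV_nonpos_imp_nonincreasing[OF assms(3)])
    fix x assume "s \<le> x" "x \<le> 1"
    then show "\<exists>y. (entropy_excess b f has_real_derivative y) (at x) \<and> y \<le> 0"
      using entropy_excess_has_derivative[of x b f] E1[of x] assms by auto
  qed
  then show ?thesis by simp
qed

text \<open>The same double integration with reversed signs. The hypothesis \<open>curv\<close>
  leaves out the end point s, so that s may be a zero of \<open>curvature\<close>; the monotonicity
  rules for open intervals then ask for the continuity facts \<open>cont\<close>.\<close>

lemma entropy_excess_neg:
  assumes "b > 0" "0 < s" "s < 1" and curv: "\<And>t. s < t \<Longrightarrow> t < 1 \<Longrightarrow> curvature b f t > 0"
  shows "entropy_excess b f s < 0"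
proof -
  let ?E1 = "\<lambda>s. (s - 1) * profile_deriv b f s - profile b f s"
  have cont: "continuous_on {t..1} ?E1" "continuous_on {t..1} (entropy_excess b f)" if "t > 0" for t
    by (rule DERIV_continuous_on[OF has_field_derivative_at_within];
        use that assms in \<open>force intro!: entropy_excess_has_derivative entropy_excess_has_derivative2\<close>)+
  have E1: "?E1 t > 0" if "s < t" "t < 1" for t
  proof -
    have "?E1 1 < ?E1 t"
    proof (rule DERIV_neg_imp_decreasing_open[OF that(2)])
      fix x assume x: "t < x" "x < 1"
      have "(x - 1) * profile_deriv2 b f x < 0"
        using curv[of x] x that assms by (simp add: mult_less_0_iff profile_deriv2_sign)
      then show "\<exists>y. (?E1 has_real_derivative y) (at x) \<and> y < 0"
        using entropy_excess_has_derivative2[of x b f] x that assms by auto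
    qed (use cont that assms in auto)
    then show ?thesis by simp
  qed
  have "entropy_excess b f s < entropy_excess b f 1"
  proof (rule DERIV_pos_imp_increasing_open[OF assms(3)])
    fix x assume "s < x" "x < 1"
    then show "\<exists>y. (entropy_excess b f has_real_derivative y) (at x) \<and> 0 < y"
      using entropy_excess_has_derivative[of x b f] E1[of x] assms by auto
  qed (use cont assms in auto)
  then show ?thesis by simp
qed

section \<open>The single sign change of the excess\<close>

lemma entropy_excess_at_zero:
  assumes "b > 2" "0 < f" "f < 1"
  shows "filterlim (entropy_excess b f) at_top (at_right 0)"
  \<comment> \<open>The leading term at 0 is f \<open>s powr (- b - 1)\<close>, coming from (s - 1)
    times the profile; the primitive only grows like \<open>s powr (- b)\<close>.\<close>
  unfolding entropy_excess_def[abs_def] profile_def profile_primitive_def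
  using assms by real_asymp

lemma entropy_excess_convex:
  assumes "b > 0" "z \<le> 1" and curv: "\<And>t. 0 < t \<Longrightarrow> t \<le> z \<Longrightarrow> curvature b f t \<le> 0"
  shows "convex_on {0<..z} (entropy_excess b f)"
proof (rule f''_ge0_imp_convex)
  fix x assume x: "x \<in> {0<..z}"
  then have x0: "x > 0" by simp
  show "(entropy_excess b f has_real_derivative (x - 1) * profile_deriv b f x - profile b f x) (at x)"
    by (rule entropy_excess_has_derivative[OF x0 assms(1)])
  show "((\<lambda>s. (s - 1) * profile_deriv b f s - profile b f s) has_real_derivative
          (x - 1) * profile_deriv2 b f x) (at x)"
    by (rule entropy_excess_has_derivative2[OF x0])
  show "0 \<le> (x - 1) * profile_deriv2 b f x"
    using curv[of x] x assms by (simp add: zero_le_mult_iff profile_deriv2_sign)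
qed simp

text \<open>Both parts compare g with a chord. Left of r, a negative value at s would put the chord
  from s to z below g r = 0; right of r, the chord from r to z is itself negative.
  \<open>comb\<close> is the chord inequality with its denominator cleared.\<close>

lemma convex_on_single_crossing:
  fixes g :: "real \<Rightarrow> real"
  assumes "convex_on {0<..z} g" "0 < r" "r < z" "g r = 0" "g z < 0"
  shows "0 < s \<Longrightarrow> s < r \<Longrightarrow> 0 \<le> g s"
    and "r < s \<Longrightarrow> s \<le> z \<Longrightarrow> g s < 0"
proof -
  have comb: "(w - u) * g v \<le> (w - v) * g u + (v - u) * g w" if "0 < u" "u < v" "v < w" "w \<le> z" for u v w
  proof -
    define t where "t = (v - u) / (w - u)"
    have t: "0 \<le> t" "t \<le> 1" using that by (auto simp: t_def)
    have v: "(1 - t) * u + t * w = v"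
      using that unfolding t_def by (simp add: divide_simps) (simp add: algebra_simps)
    have "g v \<le> (1 - t) * g u + t * g w"
      using convex_onD[OF assms(1) t, of u w] that v by simp
    then have "(w - u) * g v \<le> (w - u) * ((1 - t) * g u + t * g w)"
      using that by (intro mult_left_mono) auto
    also have "\<dots> = (w - u) * (1 - t) * g u + (w - u) * t * g w" by (simp add: algebra_simps)
    also have "(w - u) * t = v - u" using that by (simp add: t_def)
    also have "(w - u) * (1 - t) = w - v" using that \<open>(w - u) * t = v - u\<close> by (simp add: algebra_simps)
    finally show ?thesis .
  qed
  show "0 \<le> g s" if "0 < s" "s < r"
  proof -
    have "0 \<le> (z - r) * g s + (r - s) * g z" using comb[of s r z] that assms by simp
    moreover have "(r - s) * g z < 0" using that assms by (simp add: mult_less_0_iff)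
    ultimately have "0 \<le> (z - r) * g s" by linarith
    then show ?thesis using assms by (simp add: zero_le_mult_iff)
  qed
  show "g s < 0" if "r < s" "s \<le> z"
  proof (cases "s = z")
    case False
    then have "(z - r) * g s \<le> (s - r) * g z" using comb[of r s z] that assms by simp
    also have "\<dots> < 0" using that assms by (simp add: mult_less_0_iff)
    finally show ?thesis using assms by (simp add: mult_less_0_iff)
  qed (use assms in simp)
qed

lemma entropy_excess_crossing:
  assumes "b > 5" "0 < f" "f < 1" "curvature b f 1 > 0"
  obtains r where "0 < r" "r < 1"
    "\<And>s. 0 < s \<Longrightarrow> s < r \<Longrightarrow> 0 \<le> entropy_excess b f s"
    "\<And>s. r < s \<Longrightarrow> s < 1 \<Longrightarrow> entropy_excess b f s < 0"
proof -
  let ?E = "entropy_excess b f"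
  obtain z where z: "0 < z" "z < 1" "curvature b f z = 0"
    using curvature_root[OF assms] by blast
  have right: "?E s < 0" if "z \<le> s" "s < 1" for s
    using curvature_strict_mono[of z _ b f] that z assms by (intro entropy_excess_neg) auto
  have conv: "convex_on {0<..z} ?E"
  proof (rule entropy_excess_convex)
    fix t assume "0 < t" "t \<le> z"
    then show "curvature b f t \<le> 0"
      using curvature_strict_mono[of t z b f] z assms by (cases "t = z") auto
  qed (use z assms in auto)
  \<comment> \<open>The blow-up at 0 supplies a point \<open>a\<close> left of z with positive
    excess, the left end for the intermediate value theorem.\<close>
  have "eventually (\<lambda>s. 0 < ?E s) (at_right 0)"
    using entropy_excess_at_zero[of b f] assms by (simp add: filterlim_at_top_dense)
  moreover have "eventually (\<lambda>s. s \<in> {0<..<z}) (at_right 0)"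
    using z by (intro eventually_at_right_real)
  ultimately have "eventually (\<lambda>s. 0 < ?E s \<and> s \<in> {0<..<z}) (at_right 0)"
    by (rule eventually_conj)
  then obtain a where a: "0 < ?E a" "0 < a" "a < z"
    using eventually_happens by force
  have "continuous_on {a..z} ?E"
    by (rule DERIV_continuous_on[OF has_field_derivative_at_within[OF entropy_excess_has_derivative]])
       (use a assms in auto)
  then obtain r where r: "a \<le> r" "r \<le> z" "?E r = 0"
    using IVT2'[of ?E z 0 a] right[of z] z a by auto
  moreover have "r \<noteq> z" using r right[of z] z by auto
  ultimately have rz: "0 < r" "r < z" using a by auto
  note cross = convex_on_single_crossing[OF conv rz r(3) right[OF order_refl z(2)]]
  show ?thesis
  proof (rule that[of r])
    fix s assume "r < s" "s < 1"
    \<comment> \<open>Convexity decides up to z; beyond z the positive curvature does.\<close>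
    then show "?E s < 0" using cross(2)[of s] right[of s] by (cases "s \<le> z") auto
  qed (use rz z cross in auto)
qed

section \<open>Back to the stress, and the two assertions\<close>

lemma bko_stress_deriv2:
  assumes "0 < s"
  shows "deriv (deriv (bko_stress lam mu rho0 f)) (s - 1) =
         mu / rho0 * profile_deriv2 (2 * bko_beta lam mu) f s"
proof -
  define b where "b = 2 * bko_beta lam mu"
  let ?P = "bko_stress lam mu rho0 f"
  \<comment> \<open>The profile formula is available for x > -1. This set is open, so the formula
    holds near each of its points, which is what \<open>deriv\<close> depends on; the same applies
    to the first derivative before it is differentiated again.\<close>
  have ev: "eventually (\<lambda>y. y \<in> {-1<..}) (nhds x)" if "x > -1" for x :: real
    using that eventually_nhds_in_open[of "{-1<..}" x] by simp
  have shift: "((\<lambda>x. mu / rho0 * g (1 + x)) has_real_derivative mu / rho0 * g') (at x)"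
    if "(g has_real_derivative g') (at (1 + x))" for g g' x
  proof -
    have "((\<lambda>x. g (1 + x)) has_real_derivative g' * 1) (at x)"
      by (rule DERIV_chain2[where g = "\<lambda>x. 1 + x", OF that]) (auto intro!: derivative_eq_intros)
    from DERIV_cmult[OF this, of "mu / rho0"] show ?thesis by simp
  qed
  have 1: "deriv ?P x = mu / rho0 * profile_deriv b f (1 + x)" if "x > -1" for x
  proof -
    have "eventually (\<lambda>y. ?P y = mu / rho0 * profile b f (1 + y)) (nhds x)"
      using ev[OF that] by eventually_elim (simp add: bko_stress_eq b_def)
    then have "deriv ?P x = deriv (\<lambda>y. mu / rho0 * profile b f (1 + y)) x"
      by (intro deriv_cong_ev) auto
    also have "\<dots> = mu / rho0 * profile_deriv b f (1 + x)"
      using that by (intro DERIV_imp_deriv shift profile_has_derivative) auto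
    finally show ?thesis .
  qed
  have "eventually (\<lambda>y. deriv ?P y = mu / rho0 * profile_deriv b f (1 + y)) (nhds (s - 1))"
    by (rule eventually_mono[OF ev]) (use assms 1 in auto)
  then have "deriv (deriv ?P) (s - 1) = deriv (\<lambda>y. mu / rho0 * profile_deriv b f (1 + y)) (s - 1)"
    by (intro deriv_cong_ev) auto
  also have "\<dots> = mu / rho0 * profile_deriv2 b f s"
    using assms by (intro DERIV_imp_deriv shift) (simp add: profile_deriv_has_derivative)
  finally show ?thesis by (simp add: b_def)
qed

theorem mainTheorem10:
  shows
    "(\<forall>lam mu rho0 f :: real.
        0 < lam \<longrightarrow> 0 < mu \<longrightarrow> 0 < rho0 \<longrightarrow> f \<in> {0<..<1} \<longrightarrow>
        0 < bko_beta lam mu \<longrightarrow> bko_beta lam mu \<le> 5 / 2 \<longrightarrow>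
        (\<forall>s\<in>{0<..1}. deriv (deriv (bko_stress lam mu rho0 f)) (s - 1) < 0))
     \<and>
     (\<forall>(\<beta>::real) (n::int). n > 5 \<longrightarrow> \<beta> = real_of_int n / 2 \<longrightarrow>
        (\<exists>f\<^sub>\<beta>\<in>{0<..<1::real}. \<forall>f\<in>{0<..<1}.
           (f \<ge> f\<^sub>\<beta> \<longrightarrow>
              (\<forall>lam mu rho0. 0 < lam \<longrightarrow> 0 < mu \<longrightarrow> 0 < rho0 \<longrightarrow> bko_beta lam mu = \<beta> \<longrightarrow>
                 (\<forall>s\<in>{0<..1}. shock_entropy_condition (bko_stress lam mu rho0 f) (s - 1)))) \<and>
           (f < f\<^sub>\<beta> \<longrightarrow>
              (\<exists>s\<^sub>\<beta>\<in>{0<..1}.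
                 \<forall>lam mu rho0. 0 < lam \<longrightarrow> 0 < mu \<longrightarrow> 0 < rho0 \<longrightarrow> bko_beta lam mu = \<beta> \<longrightarrow>
                   (\<forall>s\<in>{0<..<s\<^sub>\<beta>}. shock_entropy_condition (bko_stress lam mu rho0 f) (s - 1)) \<and>
                   (\<forall>s\<in>{s\<^sub>\<beta><..<1}. \<not> shock_entropy_condition (bko_stress lam mu rho0 f) (s - 1)) \<and>
                   shock_entropy_condition (bko_stress lam mu rho0 f) (1 - 1)))))"
proof (intro conjI allI impI, goal_cases)
  case (1 lam mu rho0 f)
  then show ?case
    by (auto simp: bko_stress_deriv2 profile_deriv2_sign intro!: mult_pos_neg curvature_neg divide_pos_pos
        simp del: times_divide_eq_left)
next
  case (2 \<beta> n)
  define b where "b = 2 * \<beta>"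
  have b: "b > 5" using 2 by (simp add: b_def)
  \<comment> \<open>The zero in f of \<open>curvature_one\<close>; it lies in (0, 1) because 0 < b -
    5 < 2 b - 4.\<close>
  define fb where "fb = (b - 5) / (2 * b - 4)"
  have fb: "fb \<in> {0<..<1}" using b by (simp add: fb_def)
  have sign: "0 < curvature b f 1 \<longleftrightarrow> f < fb" for f
  proof -
    have "0 < curvature b f 1 \<longleftrightarrow> f * (2 * b - 4) < b - 5"
      using b by (simp add: curvature_one zero_less_mult_iff)
    also have "\<dots> \<longleftrightarrow> f < fb" using b by (simp add: fb_def pos_less_divide_eq)
    finally show ?thesis .
  qed
  \<comment> \<open>The parameters \<open>lam\<close>, \<open>mu\<close>, \<open>rho0\<close> enter
    only through \<beta>, so the threshold and the crossing point can be chosen before them.\<close>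
  have cond: "shock_entropy_condition (bko_stress lam mu rho0 f) (s - 1) \<longleftrightarrow> 0 \<le> entropy_excess b f s"
    if "0 < mu" "0 < rho0" "bko_beta lam mu = \<beta>" "0 < s" "s \<le> 1" for lam mu rho0 s f
    using shock_entropy_condition_iff[of mu rho0 lam s f] that b by (simp add: b_def)
  show ?case
  proof (intro bexI[OF _ fb] ballI conjI impI, goal_cases)
    case (1 f)
    \<comment> \<open>By monotonicity the value at 1 is the largest, and \<open>sign\<close> makes
      it nonpositive.\<close>
    have "curvature b f t \<le> 0" if "0 < t" "t \<le> 1" for t
      using curvature_strict_mono[of t 1 b f] sign[of f] that 1 b by (cases "t = 1") auto
    then have "0 \<le> entropy_excess b f s" if "s \<in> {0<..1}" for s
      using that b by (intro entropy_excess_nonneg) auto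
    then show ?case by (auto simp: cond)
  next
    case (2 f)
    then obtain r where r: "0 < r" "r < 1"
      "\<And>s. 0 < s \<Longrightarrow> s < r \<Longrightarrow> 0 \<le> entropy_excess b f s"
      "\<And>s. r < s \<Longrightarrow> s < 1 \<Longrightarrow> entropy_excess b f s < 0"
      using entropy_excess_crossing[of b f] b sign[of f] by auto
    show ?case
    proof (rule bexI[of _ r], intro allI impI conjI ballI)
      fix lam mu rho0 s :: real
      assume h: "0 < mu" "0 < rho0" "bko_beta lam mu = \<beta>"
      show "shock_entropy_condition (bko_stress lam mu rho0 f) (s - 1)" if "s \<in> {0<..<r}"
        using that h r by (simp add: cond)
      show "\<not> shock_entropy_condition (bko_stress lam mu rho0 f) (s - 1)" if "s \<in> {r<..<1}"
        using that h r(1) r(4)[of s] by (simp add: cond)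
      show "shock_entropy_condition (bko_stress lam mu rho0 f) (1 - 1)"
        using h cond[of mu rho0 lam 1 f] by simp
    qed (use r in auto)
  qed
qed

end
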